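(* Let $k$ be a field and let $A$ be an associative (not necessarily unital) $k$-algebra. The following statements are equivalent: (1) $A$ is metabelian; (2) $A$ is nilpotent with $xyzt = 0$ for all $x, y, z, t \in A$; (3) the derived algebra $A'$ is an abelian subalgebra of $A$; (4) there exist vector spaces $P$ and $V$ over $k$ and a metabelian datum $(P, V, \triangleleft, \triangleright, \theta)$ of $P$ by $V$ such that $A$ is isomorphic, as an algebra, to the metabelian product $P \star V$ associated to this datum.
   Context: All vector spaces, algebras, linear and bilinear maps are over an arbitrary field $k$. An algebra is an associative algebra, not necessarily unital: a vector space $A$ with a bilinear associative multiplication. An algebra (or subalgebra) is called abelian if its multiplication is trivial: $xy = 0$ for all $x, y$ in it. For a vector space $V$, $V_0$ denotes $V$ with the abelian algebra structure. The derived algebra $A'$ of $A$ is the linear span of all products $xy$ with $x, y \in A$. An algebra $A$ is metabelian if there exist vector spaces $V$, $P$ and an exact sequence of algebra morphisms $0 \to V_0 \xrightarrow{i} A \xrightarrow{\pi} P_0 \to 0$ (that is, $i$ is injective, $\pi$ is surjective, and $\mathrm{Im}(i) = \mathrm{Ker}(\pi)$). A metabelian datum of $P$ by $V$ is a system $(P, V, \triangleleft, \triangleright, \theta)$ consisting of vector spaces $P$, $V$ and bilinear maps $\triangleleft : V \times P \to V$, $\triangleright : P \times V \to V$, $\theta : P \times P \to V$ such that for all $p, q, r \in P$ and $x \in V$: $$(x \triangleleft p) \triangleleft q = 0, \quad p \triangleright (q \triangleright x) = 0, \quad p \triangleright (x \triangleleft q) = (p \triangleright x) \triangleleft q, \quad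 p \triangleright \theta(q, r) = \theta(p, q) \triangleleft r.$$ The associated metabelian product $P \star V$ is the vector space $P \times V$ with the (associative) multiplication $$(p, x) \star (q, y) := (0, \ \theta(p, q) + p \triangleright y + x \triangleleft q), \qquad p, q \in P, \ x, y \in V.$$ *)

theory Defs
  imports "HOL-Algebra.Module" "HOL-Algebra.AbelCoset" "HOL.Hull"
begin

text \<open>
  A vector space over a field \<open>K\<close> is a \<^locale>\<open>module\<close> over \<open>K\<close>.  The type of module records
  extends that of ring records, so the same records, with their multiplication field, also carry
  algebras.  The field for the unit is never used; where a record is built it gets a dummy value.
\<close>

definition bilinear_map ::
  "('k, 'm) ring_scheme \<Rightarrow> ('k, 'x, 'r) module_scheme \<Rightarrow> ('k, 'y, 's) module_scheme \<Rightarrow>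
    ('k, 'z, 't) module_scheme \<Rightarrow> ('x \<Rightarrow> 'y \<Rightarrow> 'z) \<Rightarrow> bool"
  where
  "bilinear_map K X Y Z f \<longleftrightarrow>
    (\<forall>x \<in> carrier X. \<forall>y \<in> carrier Y. f x y \<in> carrier Z) \<and>
    (\<forall>x \<in> carrier X. \<forall>x' \<in> carrier X. \<forall>y \<in> carrier Y.
      f (x \<oplus>\<^bsub>X\<^esub> x') y = f x y \<oplus>\<^bsub>Z\<^esub> f x' y) \<and>
    (\<forall>x \<in> carrier X. \<forall>y \<in> carrier Y. \<forall>y' \<in> carrier Y.
      f x (y \<oplus>\<^bsub>Y\<^esub> y') = f x y \<oplus>\<^bsub>Z\<^esub> f x y') \<and>
    (\<forall>c \<in> carrier K. \<forall>x \<in> carrier X. \<forall>y \<in> carrier Y.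
      f (c \<odot>\<^bsub>X\<^esub> x) y = c \<odot>\<^bsub>Z\<^esub> f x y \<and> f x (c \<odot>\<^bsub>Y\<^esub> y) = c \<odot>\<^bsub>Z\<^esub> f x y)"

text \<open>The library locale \<^locale>\<open>algebra\<close> is about commutative unital algebras.\<close>

locale assoc_algebra = module K A for K (structure) and A (structure) +
  assumes mult_bilinear: "bilinear_map K A A A (\<lambda>x y. x \<otimes>\<^bsub>A\<^esub> y)"
    and mult_assoc: "\<lbrakk>x \<in> carrier A; y \<in> carrier A; z \<in> carrier A\<rbrakk> \<Longrightarrow>
      (x \<otimes>\<^bsub>A\<^esub> y) \<otimes>\<^bsub>A\<^esub> z = x \<otimes>\<^bsub>A\<^esub> (y \<otimes>\<^bsub>A\<^esub> z)"

definition alg_hom ::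
  "('k, 'm) ring_scheme \<Rightarrow> ('k, 'a, 'r) module_scheme \<Rightarrow> ('k, 'b, 's) module_scheme \<Rightarrow> ('a \<Rightarrow> 'b) set"
  where
  "alg_hom K A B = {h \<in> carrier A \<rightarrow> carrier B.
    (\<forall>x \<in> carrier A. \<forall>y \<in> carrier A. h (x \<oplus>\<^bsub>A\<^esub> y) = h x \<oplus>\<^bsub>B\<^esub> h y) \<and>
    (\<forall>c \<in> carrier K. \<forall>x \<in> carrier A. h (c \<odot>\<^bsub>A\<^esub> x) = c \<odot>\<^bsub>B\<^esub> h x) \<and>
    (\<forall>x \<in> carrier A. \<forall>y \<in> carrier A. h (x \<otimes>\<^bsub>A\<^esub> y) = h x \<otimes>\<^bsub>B\<^esub> h y)}"

definition alg_isomorphic ::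
  "('k, 'm) ring_scheme \<Rightarrow> ('k, 'a, 'r) module_scheme \<Rightarrow> ('k, 'b, 's) module_scheme \<Rightarrow> bool"
  where
  "alg_isomorphic K A B \<longleftrightarrow> (\<exists>h \<in> alg_hom K A B. bij_betw h (carrier A) (carrier B))"

text \<open>The abelian algebra \<open>V\<^sub>0\<close> on a vector space \<open>V\<close>.\<close>

definition abelian_alg :: "('k, 'v, 'r) module_scheme \<Rightarrow> ('k, 'v, 'r) module_scheme"
  where
  "abelian_alg V = V\<lparr>mult := \<lambda>x y. \<zero>\<^bsub>V\<^esub>\<rparr>"

text \<open>
  HOL cannot quantify existentially over types, so the two type arguments say in which types the
  carriers of the vector spaces \<open>V\<close> and \<open>P\<close> are sought.
\<close>

definition metabelian ::
  "'v itself \<Rightarrow> 'p itself \<Rightarrow> ('k, 'm) ring_scheme \<Rightarrow> ('k, 'a, 'r) module_scheme \<Rightarrow> bool"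
  where
  "metabelian TV TP K A \<longleftrightarrow>
    (\<exists>(V :: ('k, 'v) module) (P :: ('k, 'p) module) i \<pi>.
      module K V \<and> module K P \<and>
      i \<in> alg_hom K (abelian_alg V) A \<and> \<pi> \<in> alg_hom K A (abelian_alg P) \<and>
      inj_on i (carrier V) \<and> \<pi> ` carrier A = carrier P \<and>
      i ` carrier V = a_kernel A P \<pi>)"

text \<open>
  The list \<open>xs\<close> has length \<open>n\<close>, so the products are those of \<open>n + 1\<close> factors; with this shift
  no empty product, hence no unit, is needed.
\<close>

definition nilpotent_alg :: "('k, 'a, 'r) module_scheme \<Rightarrow> bool"
  where
  "nilpotent_alg A \<longleftrightarrow>
    (\<exists>n. \<forall>x \<in> carrier A. \<forall>xs. set xs \<subseteq> carrier A \<and> length xs = n \<longrightarrow>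
      foldl (\<lambda>u v. u \<otimes>\<^bsub>A\<^esub> v) x xs = \<zero>\<^bsub>A\<^esub>)"

definition derived_alg :: "('k, 'm) ring_scheme \<Rightarrow> ('k, 'a, 'r) module_scheme \<Rightarrow> 'a set"
  where
  "derived_alg K A =
    (\<lambda>H. submodule H K A) hull {x \<otimes>\<^bsub>A\<^esub> y | x y. x \<in> carrier A \<and> y \<in> carrier A}"

definition abelian_subalgebra ::
  "('k, 'm) ring_scheme \<Rightarrow> ('k, 'a, 'r) module_scheme \<Rightarrow> 'a set \<Rightarrow> bool"
  where
  "abelian_subalgebra K A B \<longleftrightarrow>
    submodule B K A \<and> (\<forall>x \<in> B. \<forall>y \<in> B. x \<otimes>\<^bsub>A\<^esub> y \<in> B) \<and> (\<forall>x \<in> B. \<forall>y \<in> B. x \<otimes>\<^bsub>A\<^esub> y = \<zero>\<^bsub>A\<^esub>)"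

locale metabelian_datum = P?: module K P + V?: module K V
  for K (structure) and P (structure) and V (structure) +
  fixes ract :: "'v \<Rightarrow> 'p \<Rightarrow> 'v"  (infixl \<open>\<triangleleft>\<close> 70)
    and lact :: "'p \<Rightarrow> 'v \<Rightarrow> 'v"  (infixr \<open>\<triangleright>\<close> 70)
    and \<theta> :: "'p \<Rightarrow> 'p \<Rightarrow> 'v"
  assumes ract_bilinear: "bilinear_map K V P V ract"
    and lact_bilinear: "bilinear_map K P V V lact"
    and theta_bilinear: "bilinear_map K P P V \<theta>"
    and ract_ract: "\<lbrakk>p \<in> carrier P; q \<in> carrier P; x \<in> carrier V\<rbrakk> \<Longrightarrow> (x \<triangleleft> p) \<triangleleft> q = \<zero>\<^bsub>V\<^esub>"
    and lact_lact: "\<lbrakk>p \<in> carrier P; q \<in> carrier P; x \<in> carrier V\<rbrakk> \<Longrightarrow> p \<triangleright> (q \<triangleright> x) = \<zero>\<^bsub>V\<^esub>"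
    and lact_ract: "\<lbrakk>p \<in> carrier P; q \<in> carrier P; x \<in> carrier V\<rbrakk> \<Longrightarrow>
      p \<triangleright> (x \<triangleleft> q) = (p \<triangleright> x) \<triangleleft> q"
    and lact_theta: "\<lbrakk>p \<in> carrier P; q \<in> carrier P; r \<in> carrier P\<rbrakk> \<Longrightarrow>
      p \<triangleright> \<theta> q r = \<theta> p q \<triangleleft> r"

definition metabelian_product ::
  "('k, 'p, 'r) module_scheme \<Rightarrow> ('k, 'v, 's) module_scheme \<Rightarrow> ('v \<Rightarrow> 'p \<Rightarrow> 'v) \<Rightarrow>
    ('p \<Rightarrow> 'v \<Rightarrow> 'v) \<Rightarrow> ('p \<Rightarrow> 'p \<Rightarrow> 'v) \<Rightarrow> ('k, 'p \<times> 'v) module"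
  where
  "metabelian_product P V ract lact \<theta> =
    \<lparr>carrier = carrier P \<times> carrier V,
     mult = (\<lambda>(p, x) (q, y). (\<zero>\<^bsub>P\<^esub>, \<theta> p q \<oplus>\<^bsub>V\<^esub> lact p y \<oplus>\<^bsub>V\<^esub> ract x q)),
     one = (\<zero>\<^bsub>P\<^esub>, \<zero>\<^bsub>V\<^esub>),
     zero = (\<zero>\<^bsub>P\<^esub>, \<zero>\<^bsub>V\<^esub>),
     add = (\<lambda>(p, x) (q, y). (p \<oplus>\<^bsub>P\<^esub> q, x \<oplus>\<^bsub>V\<^esub> y)),
     smult = (\<lambda>c (p, x). (c \<odot>\<^bsub>P\<^esub> p, c \<odot>\<^bsub>V\<^esub> x))\<rparr>"

definition iso_metabelian_product ::
  "'p itself \<Rightarrow> 'v itself \<Rightarrow> ('k, 'm) ring_scheme \<Rightarrow> ('k, 'a, 'r) module_scheme \<Rightarrow> bool"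
  where
  "iso_metabelian_product TP TV K A \<longleftrightarrow>
    (\<exists>(P :: ('k, 'p) module) (V :: ('k, 'v) module) ract lact \<theta>.
      metabelian_datum K P V ract lact \<theta> \<and>
      alg_isomorphic K A (metabelian_product P V ract lact \<theta>))"

text \<open>Sanity checks: the two constructions do yield associative algebras.\<close>

lemma abelian_alg_assoc_algebra:
  assumes "module K V"
  shows "assoc_algebra K (abelian_alg V)"
proof -
  interpret module K V by fact
  have ag: "abelian_group (abelian_alg V)"
  proof (rule abelian_groupI)
    fix x assume "x \<in> carrier (abelian_alg V)"
    then show "\<exists>y \<in> carrier (abelian_alg V). y \<oplus>\<^bsub>abelian_alg V\<^esub> x = \<zero>\<^bsub>abelian_alg V\<^esub>"
      by (intro bexI[of _ "\<ominus>\<^bsub>V\<^esub> x"]) (auto simp: abelian_alg_def M.l_neg)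
  qed (auto simp: abelian_alg_def M.a_ac)
  have "module K (abelian_alg V)"
    by (rule moduleI[OF R.is_cring ag])
       (auto simp: abelian_alg_def smult_l_distr smult_r_distr smult_assoc1)
  then show ?thesis
    by (auto simp: assoc_algebra_def assoc_algebra_axioms_def bilinear_map_def abelian_alg_def)
qed

lemma (in metabelian_datum) metabelian_product_assoc_algebra:
  "assoc_algebra K (metabelian_product P V ract lact \<theta>)" (is "assoc_algebra K ?M")
proof -
  have ag: "abelian_group ?M"
  proof (rule abelian_groupI)
    fix x assume "x \<in> carrier ?M"
    then show "\<exists>y \<in> carrier ?M. y \<oplus>\<^bsub>?M\<^esub> x = \<zero>\<^bsub>?M\<^esub>"
      by (intro bexI[of _ "(\<ominus>\<^bsub>P\<^esub> fst x, \<ominus>\<^bsub>V\<^esub> snd x)"])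
         (auto simp: metabelian_product_def P.M.l_neg V.M.l_neg)
  qed (auto simp: metabelian_product_def P.M.a_ac V.M.a_ac)
  have mod: "module K ?M"
    by (rule moduleI[OF P.R.is_cring ag])
       (auto simp: metabelian_product_def P.smult_l_distr P.smult_r_distr P.smult_assoc1
          V.smult_l_distr V.smult_r_distr V.smult_assoc1)
  note bil = ract_bilinear[unfolded bilinear_map_def] lact_bilinear[unfolded bilinear_map_def]
    theta_bilinear[unfolded bilinear_map_def]
  have cl: "\<And>x p. x \<in> carrier V \<Longrightarrow> p \<in> carrier P \<Longrightarrow> x \<triangleleft> p \<in> carrier V"
    "\<And>x p. x \<in> carrier V \<Longrightarrow> p \<in> carrier P \<Longrightarrow> p \<triangleright> x \<in> carrier V"
    "\<And>p q. p \<in> carrier P \<Longrightarrow> q \<in> carrier P \<Longrightarrow> \<theta> p q \<in> carrier V"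
    using bil by auto
  have V0: "v = \<zero>\<^bsub>V\<^esub>" if "v \<oplus>\<^bsub>V\<^esub> v = v" "v \<in> carrier V" for v
    using that by simp
  have zero: "\<And>x. x \<in> carrier V \<Longrightarrow> x \<triangleleft> \<zero>\<^bsub>P\<^esub> = \<zero>\<^bsub>V\<^esub>" "\<And>x. x \<in> carrier V \<Longrightarrow> \<zero>\<^bsub>P\<^esub> \<triangleright> x = \<zero>\<^bsub>V\<^esub>"
    "\<And>p. p \<in> carrier P \<Longrightarrow> \<theta> p \<zero>\<^bsub>P\<^esub> = \<zero>\<^bsub>V\<^esub>" "\<And>p. p \<in> carrier P \<Longrightarrow> \<theta> \<zero>\<^bsub>P\<^esub> p = \<zero>\<^bsub>V\<^esub>"
    using bil P.M.l_zero[OF P.M.zero_closed] by (metis V0 cl P.M.zero_closed)+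
  have "bilinear_map K ?M ?M ?M (\<lambda>x y. x \<otimes>\<^bsub>?M\<^esub> y)"
    using bil
    by (auto simp: bilinear_map_def metabelian_product_def cl V.smult_r_distr V.M.a_ac)
  moreover have "(x \<otimes>\<^bsub>?M\<^esub> y) \<otimes>\<^bsub>?M\<^esub> z = x \<otimes>\<^bsub>?M\<^esub> (y \<otimes>\<^bsub>?M\<^esub> z)"
    if "x \<in> carrier ?M" "y \<in> carrier ?M" "z \<in> carrier ?M" for x y z
    using that bil
    by (auto simp: metabelian_product_def cl zero ract_ract lact_lact lact_ract lact_theta)
  ultimately show ?thesis
    using mod by (simp add: assoc_algebra_def assoc_algebra_axioms_def)
qed

end

theory Submission
  imports Defs
begin

text \<open>
  In a metabelian algebra every product lies in an ideal with trivial multiplication, hence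
  \<open>(xy)(zt) = 0\<close>; conversely, the annihilator of a set is a submodule, so this identity spreads
  from products to their span \<open>A'\<close>.  If \<open>A'\<close> is abelian, a linear complement \<open>P\<close> of \<open>A'\<close>, given
  by Zorn's lemma, acts on \<open>A'\<close> by left and right multiplication, and with \<open>\<theta>(p, q) = pq\<close> the map
  \<open>(p, x) \<mapsto> p + x\<close> is an isomorphism from \<open>P \<star> A'\<close> onto \<open>A\<close>.
\<close>

section \<open>Submodules and linear complements\<close>

lemma (in module) submoduleI_no_inv:
  assumes "H \<subseteq> carrier M" and "\<zero>\<^bsub>M\<^esub> \<in> H"
    and "\<And>a b. \<lbrakk>a \<in> H; b \<in> H\<rbrakk> \<Longrightarrow> a \<oplus>\<^bsub>M\<^esub> b \<in> H"
    and "\<And>a x. \<lbrakk>a \<in> carrier R; x \<in> H\<rbrakk> \<Longrightarrow> a \<odot>\<^bsub>M\<^esub> x \<in> H"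
  shows "submodule H R M"
proof (rule submoduleI)
  fix a assume a: "a \<in> H"
  then have "(\<ominus> \<one>) \<odot>\<^bsub>M\<^esub> a = \<ominus>\<^bsub>M\<^esub> a"
    using assms(1) by (subst smult_l_minus) auto
  then show "\<ominus>\<^bsub>M\<^esub> a \<in> H"
    using assms(4)[OF _ a, of "\<ominus> \<one>"] by simp
qed (use assms in auto)

lemma (in module) submodule_zero: "submodule H R M \<Longrightarrow> \<zero>\<^bsub>M\<^esub> \<in> H"
  using subgroup.one_closed[of H "add_monoid M"] by (simp add: submodule_def)

lemma (in module) submodule_Inter:
  assumes "\<S> \<noteq> {}" and "\<And>H. H \<in> \<S> \<Longrightarrow> submodule H R M"
  shows "submodule (\<Inter>\<S>) R M"
proof (rule submoduleI_no_inv)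
  show "\<Inter>\<S> \<subseteq> carrier M"
    using assms submoduleE(1) by blast
qed (use assms submodule_zero submoduleE(4,5) in auto)

text \<open>The family intersected by \<open>hull\<close> is nonempty: the whole carrier is a
  submodule containing \<open>S\<close>. Without such a member the intersection would be the
  universal set.\<close>

lemma (in module) submodule_hull:
  assumes "S \<subseteq> carrier M"
  shows "submodule ((\<lambda>H. submodule H R M) hull S) R M"
  unfolding hull_def using assms carrier_is_submodule by (intro submodule_Inter) auto

text \<open>Supplies the upper bounds for Zorn's lemma. The chain condition enters through addition:
  two elements always lie together in the larger of two members.\<close>

lemma (in module) submodule_Union_chain:
  assumes "\<C> \<noteq> {}" and "\<And>H. H \<in> \<C> \<Longrightarrow> submodule H R M"
    and chain: "\<And>H J. \<lbrakk>H \<in> \<C>; J \<in> \<C>\<rbrakk> \<Longrightarrow> H \<subseteq> J \<or> J \<subseteq> H"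
  shows "submodule (\<Union>\<C>) R M"
proof (rule submoduleI_no_inv)
  show "\<Union>\<C> \<subseteq> carrier M"
    using assms(2) submoduleE(1) by blast
  show "\<zero>\<^bsub>M\<^esub> \<in> \<Union>\<C>"
    using assms(1,2) submodule_zero by blast
  fix a b assume "a \<in> \<Union>\<C>" "b \<in> \<Union>\<C>"
  then obtain H where "H \<in> \<C>" "a \<in> H" "b \<in> H"
    using chain by blast
  then show "a \<oplus>\<^bsub>M\<^esub> b \<in> \<Union>\<C>"
    using assms(2) submoduleE(5) by blast
next
  fix a x assume "a \<in> carrier R" "x \<in> \<Union>\<C>"
  then show "a \<odot>\<^bsub>M\<^esub> x \<in> \<Union>\<C>"
    using assms(2) submoduleE(4) by blast
qed

text \<open>Adjoining one vector is the enlargement that contradicts maximality in the construction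
  of a complement.\<close>

lemma (in module) submodule_adjoin:
  assumes H: "submodule H R M" and x: "x \<in> carrier M"
  shows "submodule {u \<oplus>\<^bsub>M\<^esub> c \<odot>\<^bsub>M\<^esub> x | u c. u \<in> H \<and> c \<in> carrier R} R M" (is "submodule ?J R M")
proof (rule submoduleI_no_inv)
  note HM = subsetD[OF submoduleE(1)[OF H]]
  show "?J \<subseteq> carrier M"
    using HM x by auto
  have "\<zero>\<^bsub>M\<^esub> = \<zero>\<^bsub>M\<^esub> \<oplus>\<^bsub>M\<^esub> \<zero> \<odot>\<^bsub>M\<^esub> x"
    using x by simp
  then show "\<zero>\<^bsub>M\<^esub> \<in> ?J"
    using submodule_zero[OF H] by blast
  show "a \<oplus>\<^bsub>M\<^esub> b \<in> ?J" if ab: "a \<in> ?J" "b \<in> ?J" for a b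
  proof -
    obtain u c v d where uv: "u \<in> H" "v \<in> H" "c \<in> carrier R" "d \<in> carrier R"
      "a = u \<oplus>\<^bsub>M\<^esub> c \<odot>\<^bsub>M\<^esub> x" "b = v \<oplus>\<^bsub>M\<^esub> d \<odot>\<^bsub>M\<^esub> x"
      using ab by blast
    then have "a \<oplus>\<^bsub>M\<^esub> b = (u \<oplus>\<^bsub>M\<^esub> v) \<oplus>\<^bsub>M\<^esub> (c \<oplus> d) \<odot>\<^bsub>M\<^esub> x"
      using HM x by (simp add: smult_l_distr M.a_ac)
    then show ?thesis
      using submoduleE(5)[OF H] uv by blast
  qed
  show "a \<odot>\<^bsub>M\<^esub> b \<in> ?J" if ab: "a \<in> carrier R" "b \<in> ?J" for a b
  proof -
    obtain u c where uc: "u \<in> H" "c \<in> carrier R" "b = u \<oplus>\<^bsub>M\<^esub> c \<odot>\<^bsub>M\<^esub> x"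
      using ab by blast
    then have "a \<odot>\<^bsub>M\<^esub> b = a \<odot>\<^bsub>M\<^esub> u \<oplus>\<^bsub>M\<^esub> (a \<otimes> c) \<odot>\<^bsub>M\<^esub> x"
      using HM x ab by (simp add: smult_r_distr smult_assoc1)
    then show ?thesis
      using submoduleE(4)[OF H] uc ab by blast
  qed
qed

text \<open>Take \<open>U\<close> maximal among the submodules meeting \<open>W\<close> only in
  zero. If some \<open>x\<close> were not in \<open>U + W\<close>, adjoining \<open>x\<close> to
  \<open>U\<close> would keep the intersection with \<open>W\<close> trivial, against
  maximality.\<close>

lemma (in module) complement_exists:
  assumes "field R" and W: "submodule W R M"
  obtains U where "submodule U R M" and "U \<inter> W = {\<zero>\<^bsub>M\<^esub>}"
    and "\<And>x. x \<in> carrier M \<Longrightarrow> \<exists>u \<in> U. \<exists>w \<in> W. x = u \<oplus>\<^bsub>M\<^esub> w"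
proof -
  interpret F: field R by fact
  define \<A> where "\<A> = {U. submodule U R M \<and> U \<inter> W = {\<zero>\<^bsub>M\<^esub>}}"
  note WM = subsetD[OF submoduleE(1)[OF W]] and W0 = submodule_zero[OF W]
  have "submodule {\<zero>\<^bsub>M\<^esub>} R M"
    by (rule submoduleI_no_inv) auto
  then have "\<A> \<noteq> {}"
    using W0 unfolding \<A>_def by blast
  moreover have "\<Union>\<C> \<in> \<A>" if "\<C> \<noteq> {}" "subset.chain \<A> \<C>" for \<C>
  proof -
    have "\<C> \<subseteq> \<A>" and "\<And>H J. \<lbrakk>H \<in> \<C>; J \<in> \<C>\<rbrakk> \<Longrightarrow> H \<subseteq> J \<or> J \<subseteq> H"
      using that(2) by (auto simp: subset_chain_def)
    then have "submodule (\<Union>\<C>) R M"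
      using that(1) by (intro submodule_Union_chain) (auto simp: \<A>_def)
    then show ?thesis
      using \<open>\<C> \<subseteq> \<A>\<close> that(1) unfolding \<A>_def by blast
  qed
  ultimately obtain U where "U \<in> \<A>" and max: "\<And>X. \<lbrakk>X \<in> \<A>; U \<subseteq> X\<rbrakk> \<Longrightarrow> X = U"
    using subset_Zorn_nonempty[of \<A>] by blast
  then have U: "submodule U R M" and UW: "U \<inter> W = {\<zero>\<^bsub>M\<^esub>}"
    by (auto simp: \<A>_def)
  note UM = subsetD[OF submoduleE(1)[OF U]]
  have "\<exists>u \<in> U. \<exists>w \<in> W. x = u \<oplus>\<^bsub>M\<^esub> w" if x: "x \<in> carrier M" for x
  proof (rule ccontr)
    assume no: "\<not> ?thesis"
    define J where "J = {u \<oplus>\<^bsub>M\<^esub> c \<odot>\<^bsub>M\<^esub> x | u c. u \<in> U \<and> c \<in> carrier R}"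
    have J: "submodule J R M"
      unfolding J_def by (rule submodule_adjoin[OF U x])
    have "y = \<zero>\<^bsub>M\<^esub>" if y: "y \<in> J" "y \<in> W" for y
    proof -
      obtain u c where uc: "u \<in> U" "c \<in> carrier R" "y = u \<oplus>\<^bsub>M\<^esub> c \<odot>\<^bsub>M\<^esub> x"
        using y by (auto simp: J_def)
      \<comment> \<open>A nonzero \<open>c\<close> is invertible in the field, so
        \<open>y = u + c x\<close> could be solved for \<open>x\<close>, which would put
        \<open>x\<close> in \<open>U + W\<close>.\<close>
      have "c = \<zero>"
      proof (rule ccontr)
        assume "c \<noteq> \<zero>"
        then have c: "inv c \<in> carrier R" "inv c \<otimes> c = \<one>"
          using uc F.field_Units by auto
        have "c \<odot>\<^bsub>M\<^esub> x = \<ominus>\<^bsub>M\<^esub> u \<oplus>\<^bsub>M\<^esub> y"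
          using uc x UM by (simp add: M.r_neg1)
        then have "inv c \<odot>\<^bsub>M\<^esub> (c \<odot>\<^bsub>M\<^esub> x) = inv c \<odot>\<^bsub>M\<^esub> (\<ominus>\<^bsub>M\<^esub> u) \<oplus>\<^bsub>M\<^esub> inv c \<odot>\<^bsub>M\<^esub> y"
          by (simp only: smult_r_distr[OF c(1) M.a_inv_closed[OF UM[OF uc(1)]] WM[OF y(2)]])
        then have "x = inv c \<odot>\<^bsub>M\<^esub> (\<ominus>\<^bsub>M\<^esub> u) \<oplus>\<^bsub>M\<^esub> inv c \<odot>\<^bsub>M\<^esub> y"
          using uc c x by (simp flip: smult_assoc1)
        then show False
          using no submoduleE(3,4)[OF U] submoduleE(4)[OF W] uc y c by blast
      qed
      then have "y = u"
        using uc UM x by simp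
      then show ?thesis
        using uc y UW by blast
    qed
    then have "J \<in> \<A>"
      using J W0 submodule_zero by (auto simp: \<A>_def)
    moreover have "U \<subseteq> J"
    proof
      fix u assume "u \<in> U"
      moreover from this have "u = u \<oplus>\<^bsub>M\<^esub> \<zero> \<odot>\<^bsub>M\<^esub> x"
        using UM x by simp
      ultimately show "u \<in> J"
        unfolding J_def by blast
    qed
    ultimately have "J = U"
      by (rule max)
    moreover have "x = \<zero>\<^bsub>M\<^esub> \<oplus>\<^bsub>M\<^esub> \<one> \<odot>\<^bsub>M\<^esub> x"
      using x by simp
    then have "x \<in> J"
      using submodule_zero[OF U] unfolding J_def by blast
    \<comment> \<open>Maximality has forced \<open>x\<close> into \<open>U\<close>, so taking zero
      as its component in \<open>W\<close> gives the excluded decomposition.\<close>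
    ultimately have "x \<in> U" "x = x \<oplus>\<^bsub>M\<^esub> \<zero>\<^bsub>M\<^esub>"
      using x by simp_all
    then show False
      using no W0 by blast
  qed
  then show thesis
    using that U UW by blast
qed

section \<open>Algebra homomorphisms\<close>

lemma alg_hom_zero:
  assumes "h \<in> alg_hom K A B" and "module K A" and "module K B"
  shows "h \<zero>\<^bsub>A\<^esub> = \<zero>\<^bsub>B\<^esub>"
proof -
  interpret A: module K A by fact
  interpret B: module K B by fact
  have "h \<zero>\<^bsub>A\<^esub> \<in> carrier B" "h (\<zero>\<^bsub>K\<^esub> \<odot>\<^bsub>A\<^esub> \<zero>\<^bsub>A\<^esub>) = \<zero>\<^bsub>K\<^esub> \<odot>\<^bsub>B\<^esub> h \<zero>\<^bsub>A\<^esub>"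
    using assms(1) A.R.zero_closed A.M.zero_closed unfolding alg_hom_def by blast+
  then show ?thesis
    by simp
qed

lemma alg_hom_mult:
  "\<lbrakk>h \<in> alg_hom K A B; x \<in> carrier A; y \<in> carrier A\<rbrakk> \<Longrightarrow> h (x \<otimes>\<^bsub>A\<^esub> y) = h x \<otimes>\<^bsub>B\<^esub> h y"
  by (simp add: alg_hom_def)

lemma alg_hom_comp:
  assumes "g \<in> alg_hom K A B" and "h \<in> alg_hom K B C"
  shows "h \<circ> g \<in> alg_hom K A C"
  using assms by (auto simp: alg_hom_def Pi_iff)

section \<open>Annihilators, the derived algebra and products of four factors\<close>

context assoc_algebra
begin

lemma mult_closed [simp]: "\<lbrakk>x \<in> carrier A; y \<in> carrier A\<rbrakk> \<Longrightarrow> x \<otimes>\<^bsub>A\<^esub> y \<in> carrier A"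
  and mult_add_left: "\<lbrakk>x \<in> carrier A; y \<in> carrier A; z \<in> carrier A\<rbrakk> \<Longrightarrow>
    (x \<oplus>\<^bsub>A\<^esub> y) \<otimes>\<^bsub>A\<^esub> z = x \<otimes>\<^bsub>A\<^esub> z \<oplus>\<^bsub>A\<^esub> y \<otimes>\<^bsub>A\<^esub> z"
  and mult_add_right: "\<lbrakk>x \<in> carrier A; y \<in> carrier A; z \<in> carrier A\<rbrakk> \<Longrightarrow>
    x \<otimes>\<^bsub>A\<^esub> (y \<oplus>\<^bsub>A\<^esub> z) = x \<otimes>\<^bsub>A\<^esub> y \<oplus>\<^bsub>A\<^esub> x \<otimes>\<^bsub>A\<^esub> z"
  and mult_smult_left: "\<lbrakk>c \<in> carrier K; x \<in> carrier A; y \<in> carrier A\<rbrakk> \<Longrightarrow>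
    (c \<odot>\<^bsub>A\<^esub> x) \<otimes>\<^bsub>A\<^esub> y = c \<odot>\<^bsub>A\<^esub> (x \<otimes>\<^bsub>A\<^esub> y)"
  and mult_smult_right: "\<lbrakk>c \<in> carrier K; x \<in> carrier A; y \<in> carrier A\<rbrakk> \<Longrightarrow>
    x \<otimes>\<^bsub>A\<^esub> (c \<odot>\<^bsub>A\<^esub> y) = c \<odot>\<^bsub>A\<^esub> (x \<otimes>\<^bsub>A\<^esub> y)"
  using mult_bilinear by (simp_all add: bilinear_map_def)

lemma mult_zero_left [simp]: "x \<in> carrier A \<Longrightarrow> \<zero>\<^bsub>A\<^esub> \<otimes>\<^bsub>A\<^esub> x = \<zero>\<^bsub>A\<^esub>"
  using mult_smult_left[of \<zero> "\<zero>\<^bsub>A\<^esub>" x] by simp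

lemma mult_zero_right [simp]: "x \<in> carrier A \<Longrightarrow> x \<otimes>\<^bsub>A\<^esub> \<zero>\<^bsub>A\<^esub> = \<zero>\<^bsub>A\<^esub>"
  using mult_smult_right[of \<zero> x "\<zero>\<^bsub>A\<^esub>"] by simp

lemma submodule_right_annihilator:
  assumes "S \<subseteq> carrier A"
  shows "submodule {y \<in> carrier A. \<forall>x \<in> S. x \<otimes>\<^bsub>A\<^esub> y = \<zero>\<^bsub>A\<^esub>} K A"
  by (rule submoduleI_no_inv) (use assms in \<open>auto simp: subset_iff mult_add_right mult_smult_right\<close>)

lemma submodule_left_annihilator:
  assumes "S \<subseteq> carrier A"
  shows "submodule {y \<in> carrier A. \<forall>x \<in> S. y \<otimes>\<^bsub>A\<^esub> x = \<zero>\<^bsub>A\<^esub>} K A"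
  by (rule submoduleI_no_inv) (use assms in \<open>auto simp: subset_iff mult_add_left mult_smult_left\<close>)

text \<open>Two applications of minimality of the hull, one per factor. The right annihilator of
  \<open>S\<close> contains \<open>S\<close>, hence the hull; so the left annihilator of the hull
  contains \<open>S\<close>, hence the hull as well.\<close>

lemma hull_mult_eq_zero:
  assumes S: "S \<subseteq> carrier A" and mult: "\<And>x y. \<lbrakk>x \<in> S; y \<in> S\<rbrakk> \<Longrightarrow> x \<otimes>\<^bsub>A\<^esub> y = \<zero>\<^bsub>A\<^esub>"
    and xy: "x \<in> (\<lambda>H. submodule H K A) hull S" "y \<in> (\<lambda>H. submodule H K A) hull S"
  shows "x \<otimes>\<^bsub>A\<^esub> y = \<zero>\<^bsub>A\<^esub>"
proof -
  let ?H = "(\<lambda>H. submodule H K A) hull S"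
  have HA: "?H \<subseteq> carrier A"
    using submoduleE(1)[OF submodule_hull[OF S]] .
  have "?H \<subseteq> {y \<in> carrier A. \<forall>x \<in> S. x \<otimes>\<^bsub>A\<^esub> y = \<zero>\<^bsub>A\<^esub>}"
    using S mult by (intro hull_minimal submodule_right_annihilator) auto
  then have "?H \<subseteq> {x \<in> carrier A. \<forall>y \<in> ?H. x \<otimes>\<^bsub>A\<^esub> y = \<zero>\<^bsub>A\<^esub>}"
    using S by (intro hull_minimal submodule_left_annihilator HA) auto
  then show ?thesis
    using xy by blast
qed

lemma products_subset: "{x \<otimes>\<^bsub>A\<^esub> y | x y. x \<in> carrier A \<and> y \<in> carrier A} \<subseteq> carrier A"
  by auto

lemma submodule_derived_alg: "submodule (derived_alg K A) K A"
  unfolding derived_alg_def by (rule submodule_hull[OF products_subset])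

lemma mult_in_derived_alg: "\<lbrakk>x \<in> carrier A; y \<in> carrier A\<rbrakk> \<Longrightarrow> x \<otimes>\<^bsub>A\<^esub> y \<in> derived_alg K A"
  unfolding derived_alg_def by (rule hull_inc) blast

text \<open>By associativity \<open>xyzt = (xy)(zt)\<close>, a product of two generators of the
  derived algebra. Vanishing on generators passes to the span by
  \<open>hull_mult_eq_zero\<close>.\<close>

lemma derived_alg_abelian_iff:
  "abelian_subalgebra K A (derived_alg K A) \<longleftrightarrow>
    (\<forall>x \<in> carrier A. \<forall>y \<in> carrier A. \<forall>z \<in> carrier A. \<forall>t \<in> carrier A.
      x \<otimes>\<^bsub>A\<^esub> y \<otimes>\<^bsub>A\<^esub> z \<otimes>\<^bsub>A\<^esub> t = \<zero>\<^bsub>A\<^esub>)" (is "?L \<longleftrightarrow> ?R")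
proof
  assume ?L
  then show ?R
    by (simp add: abelian_subalgebra_def mult_in_derived_alg mult_assoc[of "_ \<otimes>\<^bsub>A\<^esub> _"])
next
  assume R: ?R
  have "x \<otimes>\<^bsub>A\<^esub> y = \<zero>\<^bsub>A\<^esub>" if "x \<in> derived_alg K A" "y \<in> derived_alg K A" for x y
    using products_subset _ that unfolding derived_alg_def
  proof (rule hull_mult_eq_zero)
    fix a b assume "a \<in> {x \<otimes>\<^bsub>A\<^esub> y | x y. x \<in> carrier A \<and> y \<in> carrier A}"
      "b \<in> {x \<otimes>\<^bsub>A\<^esub> y | x y. x \<in> carrier A \<and> y \<in> carrier A}"
    then obtain x y z t where "x \<in> carrier A" "y \<in> carrier A" "z \<in> carrier A" "t \<in> carrier A"
      "a = x \<otimes>\<^bsub>A\<^esub> y" "b = z \<otimes>\<^bsub>A\<^esub> t"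
      by blast
    then show "a \<otimes>\<^bsub>A\<^esub> b = \<zero>\<^bsub>A\<^esub>"
      using R mult_assoc[of "x \<otimes>\<^bsub>A\<^esub> y" z t] by simp
  qed
  then show ?L
    \<comment> \<open>Closure under multiplication is immediate, since all these products are
      zero.\<close>
    using submodule_derived_alg submodule_zero by (auto simp: abelian_subalgebra_def)
qed

lemma nilpotent_algI:
  assumes "\<forall>x \<in> carrier A. \<forall>y \<in> carrier A. \<forall>z \<in> carrier A. \<forall>t \<in> carrier A.
      x \<otimes>\<^bsub>A\<^esub> y \<otimes>\<^bsub>A\<^esub> z \<otimes>\<^bsub>A\<^esub> t = \<zero>\<^bsub>A\<^esub>"
  shows "nilpotent_alg A"
  unfolding nilpotent_alg_def
  \<comment> \<open>The witness is 3 although there are four factors: the first factor is not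
    counted in the list.\<close>
  by (rule exI[of _ 3]) (use assms in \<open>auto simp: numeral_3_eq_3 length_Suc_conv\<close>)

text \<open>\<open>\<pi>\<close> kills every product because multiplication in its target is
  trivial, so by exactness \<open>xy\<close> and \<open>zt\<close> lie in the image of
  \<open>i\<close>, where products vanish. The types \<open>'v\<close> and \<open>'p\<close> are
  arbitrary, which later shows that the choice of types does not matter.\<close>

lemma metabelian_imp_mult4_eq_zero:
  assumes "metabelian TYPE('v) TYPE('p) K A"
    and xyzt: "x \<in> carrier A" "y \<in> carrier A" "z \<in> carrier A" "t \<in> carrier A"
  shows "x \<otimes>\<^bsub>A\<^esub> y \<otimes>\<^bsub>A\<^esub> z \<otimes>\<^bsub>A\<^esub> t = \<zero>\<^bsub>A\<^esub>"
proof -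
  \<comment> \<open>Inside this locale \<open>'a\<close> is the type of scalars.\<close>
  obtain V :: "('a, 'v) module" and P :: "('a, 'p) module" and i \<pi>
    where V: "module K V" and P: "module K P"
      and i: "i \<in> alg_hom K (abelian_alg V) A" and \<pi>: "\<pi> \<in> alg_hom K A (abelian_alg P)"
      and exact: "i ` carrier V = a_kernel A P \<pi>"
    using assms(1) unfolding metabelian_def by blast
  have prod: "\<exists>v \<in> carrier V. a \<otimes>\<^bsub>A\<^esub> b = i v" if "a \<in> carrier A" "b \<in> carrier A" for a b
  proof -
    have "\<pi> (a \<otimes>\<^bsub>A\<^esub> b) = \<zero>\<^bsub>P\<^esub>"
      using \<pi> that by (simp add: alg_hom_def abelian_alg_def)
    then show ?thesis
      using exact that by (auto simp: a_kernel_def')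
  qed
  obtain v w where "v \<in> carrier V" "x \<otimes>\<^bsub>A\<^esub> y = i v" "w \<in> carrier V" "z \<otimes>\<^bsub>A\<^esub> t = i w"
    using prod xyzt by meson
  moreover have "i \<zero>\<^bsub>V\<^esub> = \<zero>\<^bsub>A\<^esub>"
    using alg_hom_zero[OF i assoc_algebra.axioms(1)[OF abelian_alg_assoc_algebra[OF V]] module_axioms]
    by (simp add: abelian_alg_def)
  moreover have "i v \<otimes>\<^bsub>A\<^esub> i w = i \<zero>\<^bsub>V\<^esub>" if "v \<in> carrier V" "w \<in> carrier V" for v w
    using alg_hom_mult[OF i, of v w] that by (simp add: abelian_alg_def)
  ultimately have "(x \<otimes>\<^bsub>A\<^esub> y) \<otimes>\<^bsub>A\<^esub> (z \<otimes>\<^bsub>A\<^esub> t) = \<zero>\<^bsub>A\<^esub>"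
    by metis
  then show ?thesis
    using xyzt mult_assoc[of "x \<otimes>\<^bsub>A\<^esub> y" z t] by simp
qed

text \<open>By \<open>gI\<close>, a value of the inverse is identified by applying \<open>h\<close>
  to the candidate. Each law thus reduces to the same law for \<open>h\<close>, and closure of
  \<open>A\<close> under its operations keeps the candidate in the carrier.\<close>

lemma inv_into_alg_hom:
  assumes h: "h \<in> alg_hom K A B" and bij: "bij_betw h (carrier A) (carrier B)"
  shows "inv_into (carrier A) h \<in> alg_hom K B A"
proof -
  let ?g = "inv_into (carrier A) h"
  have g: "?g b \<in> carrier A" "h (?g b) = b" if "b \<in> carrier B" for b
    using that bij by (auto simp: bij_betw_def inv_into_into f_inv_into_f)
  have gI: "?g b = a" if "h a = b" "a \<in> carrier A" for a b
    using that bij by (auto simp: bij_betw_def)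
  show ?thesis
    unfolding alg_hom_def using h by (auto simp: g alg_hom_def intro!: gI)
qed

end

section \<open>The exact sequence of a metabelian product\<close>

context metabelian_datum
begin

abbreviation prod_alg where "prod_alg \<equiv> metabelian_product P V ract lact \<theta>"

lemma mixed_maps_zero:
  "x \<in> carrier V \<Longrightarrow> x \<triangleleft> \<zero>\<^bsub>P\<^esub> = \<zero>\<^bsub>V\<^esub>"
  "x \<in> carrier V \<Longrightarrow> \<zero>\<^bsub>P\<^esub> \<triangleright> x = \<zero>\<^bsub>V\<^esub>"
  "\<theta> \<zero>\<^bsub>P\<^esub> \<zero>\<^bsub>P\<^esub> = \<zero>\<^bsub>V\<^esub>"
  using ract_bilinear lact_bilinear theta_bilinear P.smult_l_null[of "\<zero>\<^bsub>P\<^esub>"]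
    V.smult_l_null P.R.zero_closed P.M.zero_closed unfolding bilinear_map_def by metis+

text \<open>In the product of \<open>(0, x)\<close> and \<open>(0, y)\<close> each of the three
  summands has a zero argument from \<open>P\<close>, so the product vanishes as in the abelian
  algebra on \<open>V\<close>.\<close>

lemma inclusion_alg_hom: "(\<lambda>x. (\<zero>\<^bsub>P\<^esub>, x)) \<in> alg_hom K (abelian_alg V) prod_alg"
  by (auto simp: alg_hom_def abelian_alg_def metabelian_product_def mixed_maps_zero)

text \<open>Every product in \<open>prod_alg\<close> has first component zero, which matches the
  trivial multiplication on \<open>P\<close>.\<close>

lemma projection_alg_hom: "fst \<in> alg_hom K prod_alg (abelian_alg P)"
  by (auto simp: alg_hom_def abelian_alg_def metabelian_product_def)

end

text \<open>The canonical sequence from \<open>V\<close> through the metabelian product to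
  \<open>P\<close> is exact; it is transported to \<open>A\<close> along \<open>h\<close> and its
  inverse.\<close>

lemma iso_metabelian_product_imp_metabelian:
  fixes K :: "('k, 'm) ring_scheme"
  assumes "assoc_algebra K A" and iso: "iso_metabelian_product TYPE('p) TYPE('v) K A"
  shows "metabelian TYPE('v) TYPE('p) K A"
proof -
  interpret A: assoc_algebra K A by fact
  obtain P :: "('k, 'p) module" and V :: "('k, 'v) module" and ract lact \<theta> h
    where "metabelian_datum K P V ract lact \<theta>"
      and h: "h \<in> alg_hom K A (metabelian_product P V ract lact \<theta>)"
      and bij: "bij_betw h (carrier A) (carrier (metabelian_product P V ract lact \<theta>))"
    using iso unfolding iso_metabelian_product_def alg_isomorphic_def by blast
  then interpret metabelian_datum K P V ract lact \<theta> by simp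
  let ?g = "inv_into (carrier A) h"
  let ?i = "?g \<circ> (\<lambda>x. (\<zero>\<^bsub>P\<^esub>, x))" and ?\<pi> = "fst \<circ> h"
  have carrier: "carrier prod_alg = carrier P \<times> carrier V"
    by (simp add: metabelian_product_def)
  have g: "h (?g b) = b" "?g b \<in> carrier A" if "b \<in> carrier P \<times> carrier V" for b
    using that bij by (auto simp: bij_betw_def carrier inv_into_into f_inv_into_f)
  have hg: "?g (h a) = a" "h a \<in> carrier P \<times> carrier V" if "a \<in> carrier A" for a
    using that bij by (auto simp: bij_betw_def carrier)
  have "?i \<in> alg_hom K (abelian_alg V) A" "?\<pi> \<in> alg_hom K A (abelian_alg P)"
    using alg_hom_comp inclusion_alg_hom projection_alg_hom h A.inv_into_alg_hom[OF h bij] by blast+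
  moreover have "inj_on ?i (carrier V)"
    by (rule inj_on_inverseI[where g = "snd \<circ> h"]) (simp add: g)
  moreover have "?\<pi> ` carrier A = carrier P"
    \<comment> \<open>The first projection of \<open>carrier P \<times> carrier V\<close> is all of
      \<open>carrier P\<close> because \<open>carrier V\<close> contains zero and so is
      nonempty.\<close>
    using bij V.M.zero_closed
    by (auto simp only: image_comp[symmetric] bij_betw_def carrier fst_image_times split: if_splits)
  moreover have "?i ` carrier V = a_kernel A P ?\<pi>"
  proof
    show "?i ` carrier V \<subseteq> a_kernel A P ?\<pi>"
      by (auto simp: a_kernel_def' g)
    show "a_kernel A P ?\<pi> \<subseteq> ?i ` carrier V"
    proof
      fix a assume "a \<in> a_kernel A P ?\<pi>"
      then have "a \<in> carrier A" "fst (h a) = \<zero>\<^bsub>P\<^esub>"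
        by (auto simp: a_kernel_def')
      then have "a = ?i (snd (h a))" "snd (h a) \<in> carrier V"
        using hg[of a] by (auto simp flip: \<open>fst (h a) = \<zero>\<^bsub>P\<^esub>\<close>)
      then show "a \<in> ?i ` carrier V"
        by blast
    qed
  qed
  ultimately show ?thesis
    unfolding metabelian_def using P.module_axioms V.module_axioms by blast
qed

section \<open>Reconstruction of an algebra from its abelian derived algebra\<close>

text \<open>The vector spaces sought are plain \<open>module\<close> records, whereas
  \<open>A\<close> may carry further fields; \<open>module.truncate\<close> drops those and keeps
  the operations.\<close>

lemma module_truncate_submodule:
  assumes "module K A" and "submodule H K A"
  shows "module K (module.truncate (A\<lparr>carrier := H\<rparr>))"
proof -
  interpret module K "A\<lparr>carrier := H\<rparr>"
    using submodule.submodule_is_module assms by blast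
  let ?T = "module.truncate (A\<lparr>carrier := H\<rparr>)"
  have "abelian_group ?T"
  proof (rule abelian_groupI)
    fix x assume "x \<in> carrier ?T"
    then show "\<exists>y \<in> carrier ?T. y \<oplus>\<^bsub>?T\<^esub> x = \<zero>\<^bsub>?T\<^esub>"
      using M.l_neg[of x] M.a_inv_closed[of x] by (auto simp: module.defs)
  qed (use M.a_closed M.zero_closed M.a_assoc M.a_comm M.l_zero in \<open>auto simp: module.defs\<close>)
  then show ?thesis
    by (rule moduleI[OF R.is_cring])
       (use smult_closed smult_l_distr smult_r_distr smult_assoc1 smult_one
        in \<open>auto simp: module.defs\<close>)
qed

text \<open>Both vector spaces are found inside \<open>A\<close>, whose elements have type
  \<open>'c\<close> in this locale.\<close>

lemma (in assoc_algebra) derived_alg_abelian_imp_iso_metabelian_product: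
  assumes "field K" and ab: "abelian_subalgebra K A (derived_alg K A)"
  shows "iso_metabelian_product TYPE('c) TYPE('c) K A"
proof -
  let ?D = "derived_alg K A"
  have D: "submodule ?D K A"
    by (rule submodule_derived_alg)
  obtain U where U: "submodule U K A" and UD: "U \<inter> ?D = {\<zero>\<^bsub>A\<^esub>}"
    and dec: "\<And>x. x \<in> carrier A \<Longrightarrow> \<exists>u \<in> U. \<exists>w \<in> ?D. x = u \<oplus>\<^bsub>A\<^esub> w"
    using complement_exists[OF assms(1) D] by blast
  note DA [simp] = subsetD[OF submoduleE(1)[OF D]] and UA [simp] = subsetD[OF submoduleE(1)[OF U]]
  note [simp] = mult_in_derived_alg submodule_zero[OF D] submodule_zero[OF U]
    submoduleE(4,5)[OF D] submoduleE(4,5)[OF U]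
  have DD [simp]: "x \<otimes>\<^bsub>A\<^esub> y = \<zero>\<^bsub>A\<^esub>" if "x \<in> ?D" "y \<in> ?D" for x y
    using ab that by (simp add: abelian_subalgebra_def)
  define P where "P = module.truncate (A\<lparr>carrier := U\<rparr>)"
  define V where "V = module.truncate (A\<lparr>carrier := ?D\<rparr>)"
  \<comment> \<open>Both actions and \<open>\<theta>\<close> are the multiplication of
    \<open>A\<close>, used on different carriers; its values always lie in \<open>?D\<close>, the
    carrier of \<open>V\<close>.\<close>
  define m where "m = (\<lambda>x y. x \<otimes>\<^bsub>A\<^esub> y)"
  have PV [simp]: "carrier P = U" "\<zero>\<^bsub>P\<^esub> = \<zero>\<^bsub>A\<^esub>" "add P = add A" "smult P = smult A"
    "carrier V = ?D" "\<zero>\<^bsub>V\<^esub> = \<zero>\<^bsub>A\<^esub>" "add V = add A" "smult V = smult A"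
    by (simp_all add: P_def V_def module.defs)
  have modP: "module K P" and modV: "module K V"
    unfolding P_def V_def using module_truncate_submodule module_axioms D U by blast+
  interpret datum: metabelian_datum K P V m m m
  \<comment> \<open>\<open>(xp)q = x(pq)\<close> and \<open>p(qx) = (pq)x\<close> are products of
    two elements of \<open>?D\<close>, hence zero. The two compatibility laws are instances of
    associativity.\<close>
  proof (intro metabelian_datum.intro metabelian_datum_axioms.intro modP modV)
    show "m (m x p) q = \<zero>\<^bsub>V\<^esub>" if "p \<in> carrier P" "q \<in> carrier P" "x \<in> carrier V" for p q x
      using that by (simp add: m_def mult_assoc)
    show "m p (m q x) = \<zero>\<^bsub>V\<^esub>" if "p \<in> carrier P" "q \<in> carrier P" "x \<in> carrier V" for p q x
      using that by (simp add: m_def flip: mult_assoc)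
  qed (auto simp: m_def bilinear_map_def mult_assoc mult_add_left mult_add_right
        mult_smult_left mult_smult_right)
  let ?M = "metabelian_product P V m m m"
  interpret Prod: assoc_algebra K ?M
    by (rule datum.metabelian_product_assoc_algebra)
  define f where "f = (\<lambda>(p, x). p \<oplus>\<^bsub>A\<^esub> x)"
  \<comment> \<open>Expanding \<open>(p + x)(q + y)\<close> gives the metabelian product plus
    \<open>xy\<close>, and \<open>xy\<close> vanishes by \<open>DD\<close>.\<close>
  have f: "f \<in> alg_hom K ?M A"
    by (auto simp: f_def alg_hom_def metabelian_product_def m_def M.a_ac smult_r_distr
        mult_add_left mult_add_right)
  have "inj_on f (carrier ?M)"
  proof (rule inj_onI)
    fix a b assume ab: "a \<in> carrier ?M" "b \<in> carrier ?M" "f a = f b"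
    obtain u w v z where eq: "a = (u, w)" "b = (v, z)"
      by (cases a, cases b)
    then have mem: "u \<in> U" "w \<in> ?D" "v \<in> U" "z \<in> ?D" and sum: "u \<oplus>\<^bsub>A\<^esub> w = v \<oplus>\<^bsub>A\<^esub> z"
      using ab by (simp_all add: metabelian_product_def f_def)
    \<comment> \<open>Uniqueness of the decomposition: \<open>u - v = z - w\<close> lies in both
      \<open>U\<close> and \<open>?D\<close>, hence is zero.\<close>
    have "u = (v \<oplus>\<^bsub>A\<^esub> z) \<oplus>\<^bsub>A\<^esub> \<ominus>\<^bsub>A\<^esub> w"
      using mem by (simp flip: sum add: M.a_assoc M.r_neg)
    then have "\<ominus>\<^bsub>A\<^esub> v \<oplus>\<^bsub>A\<^esub> u = z \<oplus>\<^bsub>A\<^esub> \<ominus>\<^bsub>A\<^esub> w"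
      using mem by (simp add: M.a_assoc M.r_neg1)
    moreover have "\<ominus>\<^bsub>A\<^esub> v \<oplus>\<^bsub>A\<^esub> u \<in> U" "z \<oplus>\<^bsub>A\<^esub> \<ominus>\<^bsub>A\<^esub> w \<in> ?D"
      using mem submoduleE(3)[OF U] submoduleE(3)[OF D] by simp_all
    ultimately have "\<ominus>\<^bsub>A\<^esub> v \<oplus>\<^bsub>A\<^esub> u = \<zero>\<^bsub>A\<^esub>"
      using UD by auto
    then have "u = v"
      using mem M.r_neg2[of v u] by simp
    then show "a = b"
      using sum mem eq by simp
  qed
  moreover have "f ` carrier ?M = carrier A"
    using dec by (force simp: f_def metabelian_product_def)
  ultimately have bij: "bij_betw f (carrier ?M) (carrier A)"
    by (simp add: bij_betw_def)
  \<comment> \<open>The isomorphism has to start at \<open>A\<close>, so \<open>f\<close> is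
    inverted; this uses that \<open>?M\<close> is itself an associative algebra.\<close>
  then have "alg_isomorphic K A ?M"
    unfolding alg_isomorphic_def
    using Prod.inv_into_alg_hom[OF f bij] bij_betw_inv_into by blast
  then show ?thesis
    unfolding iso_metabelian_product_def using datum.metabelian_datum_axioms by blast
qed

text \<open>The last two conjuncts justify the choice of types in the first three: vector spaces in
  any types yield vector spaces in the type of the elements of \<open>A\<close>.\<close>

theorem theorem2p3:
  fixes K :: "('k, 'm) ring_scheme" and A :: "('k, 'a, 'r) module_scheme"
  assumes "field K" and "assoc_algebra K A"
  shows
    "(metabelian TYPE('a) TYPE('a) K A \<longleftrightarrow>
        nilpotent_alg A \<and>
        (\<forall>x \<in> carrier A. \<forall>y \<in> carrier A. \<forall>z \<in> carrier A. \<forall>t \<in> carrier A.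
          x \<otimes>\<^bsub>A\<^esub> y \<otimes>\<^bsub>A\<^esub> z \<otimes>\<^bsub>A\<^esub> t = \<zero>\<^bsub>A\<^esub>)) \<and>
     (metabelian TYPE('a) TYPE('a) K A \<longleftrightarrow> abelian_subalgebra K A (derived_alg K A)) \<and>
     (metabelian TYPE('a) TYPE('a) K A \<longleftrightarrow> iso_metabelian_product TYPE('a) TYPE('a) K A) \<and>
     (metabelian TYPE('v) TYPE('p) K A \<longrightarrow> metabelian TYPE('a) TYPE('a) K A) \<and>
     (iso_metabelian_product TYPE('p) TYPE('v) K A \<longrightarrow> iso_metabelian_product TYPE('a) TYPE('a) K A)"
proof -
  interpret assoc_algebra K A by fact
  \<comment> \<open>Type variables are fixed within the proof, so the implications are stated once
    for \<open>'v\<close> and \<open>'p\<close> and once for \<open>'a\<close>. Together with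
    \<open>b\<close> they close the cycle.\<close>
  have a: "metabelian TYPE('v) TYPE('p) K A \<Longrightarrow> abelian_subalgebra K A (derived_alg K A)"
    and a': "metabelian TYPE('a) TYPE('a) K A \<Longrightarrow> abelian_subalgebra K A (derived_alg K A)"
    unfolding derived_alg_abelian_iff using metabelian_imp_mult4_eq_zero by blast+
  have b: "abelian_subalgebra K A (derived_alg K A) \<Longrightarrow> iso_metabelian_product TYPE('a) TYPE('a) K A"
    by (rule derived_alg_abelian_imp_iso_metabelian_product[OF assms(1)])
  have c: "iso_metabelian_product TYPE('p) TYPE('v) K A \<Longrightarrow> metabelian TYPE('v) TYPE('p) K A"
    and c': "iso_metabelian_product TYPE('a) TYPE('a) K A \<Longrightarrow> metabelian TYPE('a) TYPE('a) K A"
    by (erule iso_metabelian_product_imp_metabelian[OF assms(2)])+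
  show ?thesis
    using a a' b c c' derived_alg_abelian_iff nilpotent_algI by blast
qed

end
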